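(* For any positive integer $k$, the number $r_k$ of equivalence classes of the relation $\equiv_k^{\mathrm{MSO};\,\mathrm{graphs}}$ on the set of all finite graphs satisfies $$r_k\leq T(k+2+\log^*(k)).$$
   Context: Graphs are finite, undirected, without loops and multiple edges. Monadic second order (MSO) formulae of graphs are built from the relational symbols $\sim$ (adjacency) and $=$, the logical connectives $\neg,\Rightarrow,\Leftrightarrow,\vee,\wedge$, first order variables $x,y,x_1,\ldots$ (ranging over vertices), monadic variables $X,Y,X_1,\ldots$ (ranging over unary predicates, i.e. subsets of the vertex set; $X(x)$ means $x\in X$), and quantifiers $\forall,\exists$ over both kinds of variables. The quantifier depth $q(\phi)$ of a formula $\phi$ is the number of quantifiers (of both kinds) in the longest chain of nested quantifiers of $\phi$. For graphs $G,H$ and a positive integer $k$, $G\equiv_k^{\mathrm{MSO};\,\mathrm{graphs}}H$ means that every MSO sentence $\phi$ with $q(\phi)\leq k$ is either true on both $G$ and $H$ or false on both. The tower function is defined by $T(1)=2$, $T(s)=2^{T(s-1)}$ for integers $s\ge 2$, and $\log^*(k)=\min\{i\geq 1:\,T(i)\geq k\}$. *)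

theory Defs
  imports "Graph_Theory.Pair_Digraph"
begin

(* First-order variables and set variables are two separate supplies, both named by nat. *)
datatype mso =
    Adj nat nat
  | Eq nat nat
  | Mem nat nat  \<comment> \<open>\<open>Mem X x\<close> is the atom X(x): first argument a set variable, second a vertex variable\<close>
  | Neg mso
  | And mso mso
  | Or mso mso
  | Imp mso mso
  | Iff mso mso
  | All1 nat mso
  | Ex1 nat mso
  | All2 nat mso
  | Ex2 nat mso

primrec qdepth :: "mso \<Rightarrow> nat" where
  "qdepth (Adj x y) = 0"
| "qdepth (Eq x y) = 0"
| "qdepth (Mem X x) = 0"
| "qdepth (Neg p) = qdepth p"
| "qdepth (And p q) = max (qdepth p) (qdepth q)"
| "qdepth (Or p q) = max (qdepth p) (qdepth q)"
| "qdepth (Imp p q) = max (qdepth p) (qdepth q)"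
| "qdepth (Iff p q) = max (qdepth p) (qdepth q)"
| "qdepth (All1 x p) = Suc (qdepth p)"
| "qdepth (Ex1 x p) = Suc (qdepth p)"
| "qdepth (All2 X p) = Suc (qdepth p)"
| "qdepth (Ex2 X p) = Suc (qdepth p)"

primrec free1 :: "mso \<Rightarrow> nat set" where
  "free1 (Adj x y) = {x, y}"
| "free1 (Eq x y) = {x, y}"
| "free1 (Mem X x) = {x}"
| "free1 (Neg p) = free1 p"
| "free1 (And p q) = free1 p \<union> free1 q"
| "free1 (Or p q) = free1 p \<union> free1 q"
| "free1 (Imp p q) = free1 p \<union> free1 q"
| "free1 (Iff p q) = free1 p \<union> free1 q"
| "free1 (All1 x p) = free1 p - {x}"
| "free1 (Ex1 x p) = free1 p - {x}"
| "free1 (All2 X p) = free1 p"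
| "free1 (Ex2 X p) = free1 p"

primrec free2 :: "mso \<Rightarrow> nat set" where
  "free2 (Adj x y) = {}"
| "free2 (Eq x y) = {}"
| "free2 (Mem X x) = {X}"
| "free2 (Neg p) = free2 p"
| "free2 (And p q) = free2 p \<union> free2 q"
| "free2 (Or p q) = free2 p \<union> free2 q"
| "free2 (Imp p q) = free2 p \<union> free2 q"
| "free2 (Iff p q) = free2 p \<union> free2 q"
| "free2 (All1 x p) = free2 p"
| "free2 (Ex1 x p) = free2 p"
| "free2 (All2 X p) = free2 p - {X}"
| "free2 (Ex2 X p) = free2 p - {X}"

definition sentence :: "mso \<Rightarrow> bool" where
  "sentence p \<longleftrightarrow> free1 p = {} \<and> free2 p = {}"

primrec sat :: "'a pair_pre_digraph \<Rightarrow> (nat \<Rightarrow> 'a) \<Rightarrow> (nat \<Rightarrow> 'a set) \<Rightarrow> mso \<Rightarrow> bool" where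
  "sat G e E (Adj x y) \<longleftrightarrow> (e x, e y) \<in> parcs G"
| "sat G e E (Eq x y) \<longleftrightarrow> e x = e y"
| "sat G e E (Mem X x) \<longleftrightarrow> e x \<in> E X"
| "sat G e E (Neg p) \<longleftrightarrow> \<not> sat G e E p"
| "sat G e E (And p q) \<longleftrightarrow> sat G e E p \<and> sat G e E q"
| "sat G e E (Or p q) \<longleftrightarrow> sat G e E p \<or> sat G e E q"
| "sat G e E (Imp p q) \<longleftrightarrow> (sat G e E p \<longrightarrow> sat G e E q)"
| "sat G e E (Iff p q) \<longleftrightarrow> (sat G e E p \<longleftrightarrow> sat G e E q)"
| "sat G e E (All1 x p) \<longleftrightarrow> (\<forall>v \<in> pverts G. sat G (e(x := v)) E p)"
| "sat G e E (Ex1 x p) \<longleftrightarrow> (\<exists>v \<in> pverts G. sat G (e(x := v)) E p)"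
| "sat G e E (All2 X p) \<longleftrightarrow> (\<forall>S. S \<subseteq> pverts G \<longrightarrow> sat G e (E(X := S)) p)"
| "sat G e E (Ex2 X p) \<longleftrightarrow> (\<exists>S. S \<subseteq> pverts G \<and> sat G e (E(X := S)) p)"

lemma sat_cong:
  "(\<And>x. x \<in> free1 p \<Longrightarrow> e x = e' x) \<Longrightarrow> (\<And>X. X \<in> free2 p \<Longrightarrow> E X = E' X) \<Longrightarrow>
   sat G e E p \<longleftrightarrow> sat G e' E' p"
proof (induction p arbitrary: e e' E E')
  case (All1 x p)
  have "sat G (e(x := v)) E p \<longleftrightarrow> sat G (e'(x := v)) E' p" for v
    by (rule All1.IH) (use All1.prems in auto)
  then show ?case by simp
next
  case (Ex1 x p)
  have "sat G (e(x := v)) E p \<longleftrightarrow> sat G (e'(x := v)) E' p" for v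
    by (rule Ex1.IH) (use Ex1.prems in auto)
  then show ?case by simp
next
  case (All2 X p)
  have "sat G e (E(X := S)) p \<longleftrightarrow> sat G e' (E'(X := S)) p" for S
    by (rule All2.IH) (use All2.prems in auto)
  then show ?case by simp
next
  case (Ex2 X p)
  have "sat G e (E(X := S)) p \<longleftrightarrow> sat G e' (E'(X := S)) p" for S
    by (rule Ex2.IH) (use Ex2.prems in auto)
  then show ?case by simp
next
  case (Neg p)
  have "sat G e E p \<longleftrightarrow> sat G e' E' p" by (rule Neg.IH) (use Neg.prems in auto)
  then show ?case by simp
next
  case (And p q)
  have "sat G e E p \<longleftrightarrow> sat G e' E' p" by (rule And.IH(1)) (use And.prems in auto)
  moreover have "sat G e E q \<longleftrightarrow> sat G e' E' q" by (rule And.IH(2)) (use And.prems in auto)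
  ultimately show ?case by simp
next
  case (Or p q)
  have "sat G e E p \<longleftrightarrow> sat G e' E' p" by (rule Or.IH(1)) (use Or.prems in auto)
  moreover have "sat G e E q \<longleftrightarrow> sat G e' E' q" by (rule Or.IH(2)) (use Or.prems in auto)
  ultimately show ?case by simp
next
  case (Imp p q)
  have "sat G e E p \<longleftrightarrow> sat G e' E' p" by (rule Imp.IH(1)) (use Imp.prems in auto)
  moreover have "sat G e E q \<longleftrightarrow> sat G e' E' q" by (rule Imp.IH(2)) (use Imp.prems in auto)
  ultimately show ?case by simp
next
  case (Iff p q)
  have "sat G e E p \<longleftrightarrow> sat G e' E' p" by (rule Iff.IH(1)) (use Iff.prems in auto)
  moreover have "sat G e E q \<longleftrightarrow> sat G e' E' q" by (rule Iff.IH(2)) (use Iff.prems in auto)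
  ultimately show ?case by simp
qed auto

(* The environments are arbitrary: by sat_cong a sentence does not depend on them. They are not
   required to take values in the graph, so that the definition also makes sense for the graph
   without vertices. *)
definition models :: "'a pair_pre_digraph \<Rightarrow> mso \<Rightarrow> bool" where
  "models G p \<longleftrightarrow> sat G (\<lambda>_. undefined) (\<lambda>_. {}) p"

lemma models_iff_sat: "sentence p \<Longrightarrow> models G p \<longleftrightarrow> sat G e E p"
  unfolding models_def sentence_def by (rule sat_cong) auto

(* pair_graph: finitely many vertices, and the set of arcs is a symmetric irreflexive relation on
   the vertices. The vertex set may be empty. For an infinite type 'a, every finite graph has an
   isomorphic copy here. *)
definition finite_graphs :: "'a pair_pre_digraph set" where
  "finite_graphs = {G. pair_graph G}"

definition mso_equiv :: "nat \<Rightarrow> ('a pair_pre_digraph \<times> 'a pair_pre_digraph) set" where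
  "mso_equiv k = {(G, H). G \<in> finite_graphs \<and> H \<in> finite_graphs \<and>
     (\<forall>p. sentence p \<and> qdepth p \<le> k \<longrightarrow> (models G p \<longleftrightarrow> models H p))}"

lemma equiv_mso_equiv: "equiv finite_graphs (mso_equiv k)"
  by (rule equivI) (auto simp: mso_equiv_def refl_on_def sym_def trans_def)

(* The value 1 at 0 is chosen so that tower 1 = 2. *)
primrec tower :: "nat \<Rightarrow> nat" where
  "tower 0 = 1"
| "tower (Suc s) = 2 ^ tower s"

lemma less_tower: "n < tower n"
proof (induction n)
  case (Suc n)
  have "Suc n \<le> tower n" using Suc by simp
  also have "\<dots> < 2 ^ tower n" by (rule less_exp)
  finally show ?case by simp
qed simp

definition log_star :: "nat \<Rightarrow> nat" where
  "log_star k = (LEAST i. 1 \<le> i \<and> k \<le> tower i)"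

end

theory Submission
  imports Defs "HOL-Library.Nat_Bijection"
begin

text \<open>
  A structure with \<open>m\<close> distinguished vertices, \<open>n\<close> distinguished vertex sets and \<open>q\<close> remaining
  quantifiers is assigned its Ehrenfeucht--Fraisse type, coded as a natural number: for \<open>q = 0\<close> the
  atomic diagram, for \<open>q + 1\<close> the set of all \<open>q\<close>-types of one-point and of one-set extensions.
  Equal codes imply agreement on formulas of depth \<open>q\<close>. If \<open>m + n = k\<close>, there are at most
  \<open>2 ^ (k * (k - 1))\<close> atomic diagrams, and each quantifier step takes a bound \<open>M\<close> on the number of
  types to \<open>2 ^ (2 * M)\<close>; the factor 2 and the initial exponent are absorbed by the
  inequality \<open>2 * M + 2 \<le> T (q + log* k + 2)\<close>, which is stable under such steps.
\<close>

section \<open>Coded types and their number\<close>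

lemma set_encode_less_power2:
  assumes "A \<subseteq> {..<n}"
  shows "set_encode A < 2 ^ n"
proof -
  have "set_encode A \<le> (\<Sum>i<n. 2 ^ i)"
    unfolding set_encode_def using assms by (intro sum_mono2) auto
  also have "\<dots> < (2::nat) ^ n"
    by (induction n) auto
  finally show ?thesis .
qed

text \<open>
  With \<open>m\<close> vertices and \<open>n\<close> sets, the atomic diagram is determined by the bits \<open>(i, j)\<close> with \<open>i < m\<close>
  and \<open>j < m + n - 1\<close>: below the diagonal they record adjacency, above it they record
  equality, shifted by one column since the diagonal carries no information; the columns
  from \<open>m - 1\<close> on record membership.
\<close>

definition diagram_bit :: "'a pair_pre_digraph \<Rightarrow> 'a list \<Rightarrow> 'a set list \<Rightarrow> nat \<Rightarrow> nat \<Rightarrow> bool" where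
  "diagram_bit G xs Xs i j \<longleftrightarrow>
     (if j < i then (xs ! i, xs ! j) \<in> parcs G
      else if Suc j < length xs then xs ! i = xs ! Suc j
      else xs ! i \<in> Xs ! (Suc j - length xs))"

definition diagram :: "'a pair_pre_digraph \<Rightarrow> 'a list \<Rightarrow> 'a set list \<Rightarrow> nat set" where
  "diagram G xs Xs = (let w = length xs + length Xs - 1 in
     {b. b < length xs * w \<and> diagram_bit G xs Xs (b div w) (b mod w)})"

text \<open>Even elements stand for vertex extensions and odd ones for set extensions, so a single
  number keeps the two families apart.\<close>

primrec ef_type :: "nat \<Rightarrow> 'a pair_pre_digraph \<Rightarrow> 'a list \<Rightarrow> 'a set list \<Rightarrow> nat" where
  "ef_type 0 G xs Xs = set_encode (diagram G xs Xs)"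
| "ef_type (Suc q) G xs Xs = set_encode
     ((\<lambda>v. 2 * ef_type q G (xs @ [v]) Xs) ` pverts G \<union>
      (\<lambda>S. 2 * ef_type q G xs (Xs @ [S]) + 1) ` Pow (pverts G))"

text \<open>The parameter \<open>k\<close> is the number of distinguished vertices and sets plus the
  number of remaining quantifiers. A diagram has \<open>m * (m + n - 1)\<close> bits, at most
  \<open>k * (k - 1)\<close> when \<open>m + n = k\<close>.\<close>

primrec type_bound :: "nat \<Rightarrow> nat \<Rightarrow> nat" where
  "type_bound k 0 = 2 ^ (k * (k - 1))"
| "type_bound k (Suc q) = 2 ^ (2 * type_bound k q)"

text \<open>Each extension trades one quantifier for one list entry, so the sum \<open>k\<close> is
  invariant. If all types \<open>t\<close> of the extensions are below \<open>M\<close>, then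
  \<open>2 * t\<close> and \<open>2 * t + 1\<close> are below \<open>2 * M\<close>, and a set of
  such numbers has a code below \<open>2 ^ (2 * M)\<close>.\<close>

lemma ef_type_less_type_bound:
  "length xs + length Xs + q = k \<Longrightarrow> ef_type q G xs Xs < type_bound k q"
proof (induction q arbitrary: xs Xs)
  case 0
  have "diagram G xs Xs \<subseteq> {..<length xs * (k - 1)}"
    using 0 by (auto simp: diagram_def Let_def)
  also have "\<dots> \<subseteq> {..<k * (k - 1)}"
    using 0 by (auto elim!: less_le_trans)
  finally show ?case
    using set_encode_less_power2 by simp
next
  case (Suc q)
  have "ef_type q G (xs @ [v]) Xs < type_bound k q" for v
    using Suc by simp
  moreover have "Suc (2 * ef_type q G xs (Xs @ [S])) < 2 * type_bound k q" for S
  proof -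
    have "ef_type q G xs (Xs @ [S]) < type_bound k q"
      using Suc by simp
    then show ?thesis by linarith
  qed
  ultimately show ?case
    by (auto intro!: set_encode_less_power2)
qed

section \<open>Atomic facts recovered from the diagram\<close>

lemma diagram_bit_cong:
  assumes eq: "diagram G xs Xs = diagram H ys Ys"
    and len: "length xs = length ys" "length Xs = length Ys"
    and ij: "i < length xs" "j < length xs + length Xs - 1"
  shows "diagram_bit G xs Xs i j \<longleftrightarrow> diagram_bit H ys Ys i j"
proof -
  define w where "w = length xs + length Xs - 1"
  have "i * w + j < Suc i * w"
    using ij by (simp add: w_def)
  also have "\<dots> \<le> length xs * w"
    using ij by (intro mult_le_mono1) simp
  finally have "i * w + j < length xs * w" .
  moreover have "(i * w + j) div w = i" "(i * w + j) mod w = j"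
    using ij by (auto simp: w_def)
  moreover have "i * w + j \<in> diagram G xs Xs \<longleftrightarrow> i * w + j \<in> diagram H ys Ys"
    using eq by simp
  ultimately show ?thesis
    using len by (simp add: diagram_def Let_def w_def)
qed

lemma diagram_cong:
  assumes G: "pair_graph G" and H: "pair_graph H"
    and eq: "diagram G xs Xs = diagram H ys Ys"
    and len: "length xs = length ys" "length Xs = length Ys"
    and i: "i < length xs"
  shows diagram_cong_adj:
      "j < length xs \<Longrightarrow> (xs ! i, xs ! j) \<in> parcs G \<longleftrightarrow> (ys ! i, ys ! j) \<in> parcs H"
    and diagram_cong_eq: "j < length xs \<Longrightarrow> xs ! i = xs ! j \<longleftrightarrow> ys ! i = ys ! j"
    and diagram_cong_mem: "n < length Xs \<Longrightarrow> xs ! i \<in> Xs ! n \<longleftrightarrow> ys ! i \<in> Ys ! n"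
proof -
  note bit = diagram_bit_cong[OF eq len]
  interpret G: pair_graph G by fact
  interpret H: pair_graph H by fact
  have adj: "(xs ! a, xs ! b) \<in> parcs G \<longleftrightarrow> (ys ! a, ys ! b) \<in> parcs H"
    if "b < a" "a < length xs" for a b
    using bit[of a b] that by (simp add: diagram_bit_def)
  \<comment> \<open>Equality of entries \<open>a < b\<close> is stored in column
    \<open>b - 1\<close>.\<close>
  have equ: "xs ! a = xs ! b \<longleftrightarrow> ys ! a = ys ! b" if "a < b" "b < length xs" for a b
    using bit[of a "b - 1"] that len by (cases b) (auto simp: diagram_bit_def)
  \<comment> \<open>Only pairs below the diagonal are stored: symmetry gives those above it, and
    irreflexivity the diagonal.\<close>
  show "(xs ! i, xs ! j) \<in> parcs G \<longleftrightarrow> (ys ! i, ys ! j) \<in> parcs H" if "j < length xs"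
    using adj[of i j] adj[of j i] i that G.no_loops' H.no_loops'
      G.arcs_symmetric H.arcs_symmetric by (metis linorder_neqE_nat)
  show "xs ! i = xs ! j \<longleftrightarrow> ys ! i = ys ! j" if "j < length xs"
    using equ[of i j] equ[of j i] i that by (metis linorder_neqE_nat)
  \<comment> \<open>Membership in set \<open>n\<close> occupies column
    \<open>length xs + n - 1\<close>; the truncated subtraction is harmless since
    \<open>i < length xs\<close>.\<close>
  show "xs ! i \<in> Xs ! n \<longleftrightarrow> ys ! i \<in> Ys ! n" if "n < length Xs"
    using bit[of i "length xs + n - 1"] that i len by (cases "length ys") (auto simp: diagram_bit_def)
qed

section \<open>Back-and-forth and quantifiers\<close>

lemma ef_type_Suc_eqD:
  fixes G H :: "'a pair_pre_digraph"
  assumes fin: "finite (pverts G)" "finite (pverts H)"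
    and eq: "ef_type (Suc q) G xs Xs = ef_type (Suc q) H ys Ys"
  shows ef_type_extend_vertex:
      "v \<in> pverts G \<Longrightarrow> \<exists>w\<in>pverts H. ef_type q G (xs @ [v]) Xs = ef_type q H (ys @ [w]) Ys"
    and ef_type_extend_set:
      "S \<subseteq> pverts G \<Longrightarrow> \<exists>R\<subseteq>pverts H. ef_type q G xs (Xs @ [S]) = ef_type q H ys (Ys @ [R])"
proof -
  define codes where "codes K zs Zs =
     (\<lambda>v. 2 * ef_type q K (zs @ [v]) Zs) ` pverts K \<union>
     (\<lambda>S. 2 * ef_type q K zs (Zs @ [S]) + 1) ` Pow (pverts K)" for K :: "'a pair_pre_digraph" and zs Zs
  \<comment> \<open>\<open>set_encode\<close> is injective on finite sets, and finitely many
    vertices leave only finitely many extensions.\<close>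
  have codes: "codes G xs Xs = codes H ys Ys"
    using eq fin unfolding codes_def by (simp add: set_encode_eq)
  have parity: "2 * a \<noteq> 2 * b + 1" "2 * b + 1 \<noteq> 2 * a" for a b :: nat
    by presburger+
  show "\<exists>w\<in>pverts H. ef_type q G (xs @ [v]) Xs = ef_type q H (ys @ [w]) Ys" if "v \<in> pverts G"
  proof -
    have "2 * ef_type q G (xs @ [v]) Xs \<in> codes H ys Ys"
      using that unfolding codes[symmetric] by (auto simp: codes_def)
    then show ?thesis
      using parity by (auto simp: codes_def)
  qed
  show "\<exists>R\<subseteq>pverts H. ef_type q G xs (Xs @ [S]) = ef_type q H ys (Ys @ [R])" if "S \<subseteq> pverts G"
  proof -
    have "2 * ef_type q G xs (Xs @ [S]) + 1 \<in> codes H ys Ys"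
      using that unfolding codes[symmetric] by (auto simp: codes_def)
    then show ?thesis
      using parity by (auto simp: codes_def)
  qed
qed

text \<open>Appending leaves the old positions intact. The old position of \<open>x\<close> may be
  out of range, because \<open>x\<close> is redirected to the new entry.\<close>

lemma sat_append_vertex:
  assumes "\<And>y. y \<in> free1 p - {x} \<Longrightarrow> a y < length xs"
  shows "sat G ((\<lambda>y. xs ! a y)(x := v)) E p \<longleftrightarrow>
    sat G (\<lambda>y. (xs @ [v]) ! (a(x := length xs)) y) E p"
  by (rule sat_cong) (use assms in \<open>auto simp: nth_append\<close>)

lemma sat_append_set:
  assumes "\<And>Y. Y \<in> free2 p - {X} \<Longrightarrow> b Y < length Xs"
  shows "sat G e ((\<lambda>Y. Xs ! b Y)(X := S)) p \<longleftrightarrow>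
    sat G e (\<lambda>Y. (Xs @ [S]) ! (b(X := length Xs)) Y) p"
  by (rule sat_cong) (use assms in \<open>auto simp: nth_append\<close>)

lemma image_eqI_back_and_forth:
  assumes "\<And>x. x \<in> A \<Longrightarrow> \<exists>y\<in>B. r x = s y" and "\<And>y. y \<in> B \<Longrightarrow> \<exists>x\<in>A. s y = r x"
    and "\<And>x y. r x = s y \<Longrightarrow> f x = g y"
  shows "f ` A = g ` B"
proof (intro equalityI image_subsetI)
  show "f x \<in> g ` B" if "x \<in> A" for x
    using assms(1)[OF that] assms(3) by blast
  show "g y \<in> f ` A" if "y \<in> B" for y
    using assms(2)[OF that] assms(3) by (metis image_eqI)
qed

text \<open>Both \<open>All1\<close> and \<open>Ex1\<close> depend only on the set of truth values
  that the body attains, so equality of these sets settles both quantifiers at once.\<close>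

lemma ef_type_extend_vertex_sat:
  fixes G H :: "'a pair_pre_digraph"
  assumes fin: "finite (pverts G)" "finite (pverts H)"
    and eq: "ef_type (Suc q) G xs Xs = ef_type (Suc q) H ys Ys"
    and len: "length xs = length ys" "length Xs = length Ys"
    and a: "\<And>y. y \<in> free1 p - {x} \<Longrightarrow> a y < length xs"
    and step: "\<And>v w. ef_type q G (xs @ [v]) Xs = ef_type q H (ys @ [w]) Ys \<Longrightarrow>
      sat G (\<lambda>y. (xs @ [v]) ! (a(x := length xs)) y) (\<lambda>Y. Xs ! b Y) p \<longleftrightarrow>
      sat H (\<lambda>y. (ys @ [w]) ! (a(x := length xs)) y) (\<lambda>Y. Ys ! b Y) p"
  shows "(\<lambda>v. sat G ((\<lambda>y. xs ! a y)(x := v)) (\<lambda>Y. Xs ! b Y) p) ` pverts G =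
    (\<lambda>w. sat H ((\<lambda>y. ys ! a y)(x := w)) (\<lambda>Y. Ys ! b Y) p) ` pverts H"
proof -
  have sat_eq: "sat G ((\<lambda>y. xs ! a y)(x := v)) (\<lambda>Y. Xs ! b Y) p \<longleftrightarrow>
      sat H ((\<lambda>y. ys ! a y)(x := w)) (\<lambda>Y. Ys ! b Y) p"
    if "ef_type q G (xs @ [v]) Xs = ef_type q H (ys @ [w]) Ys" for v w
    using step[OF that] sat_append_vertex[of p x a xs G v] sat_append_vertex[of p x a ys H w] a len
    by simp
  show ?thesis
    using ef_type_extend_vertex[OF fin eq] ef_type_extend_vertex[OF fin(2,1) eq[symmetric]]
    by (rule image_eqI_back_and_forth[OF _ _ sat_eq])
qed

lemma ef_type_extend_set_sat:
  fixes G H :: "'a pair_pre_digraph"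
  assumes fin: "finite (pverts G)" "finite (pverts H)"
    and eq: "ef_type (Suc q) G xs Xs = ef_type (Suc q) H ys Ys"
    and len: "length xs = length ys" "length Xs = length Ys"
    and b: "\<And>Y. Y \<in> free2 p - {X} \<Longrightarrow> b Y < length Xs"
    and step: "\<And>S R. ef_type q G xs (Xs @ [S]) = ef_type q H ys (Ys @ [R]) \<Longrightarrow>
      sat G (\<lambda>y. xs ! a y) (\<lambda>Y. (Xs @ [S]) ! (b(X := length Xs)) Y) p \<longleftrightarrow>
      sat H (\<lambda>y. ys ! a y) (\<lambda>Y. (Ys @ [R]) ! (b(X := length Xs)) Y) p"
  shows "(\<lambda>S. sat G (\<lambda>y. xs ! a y) ((\<lambda>Y. Xs ! b Y)(X := S)) p) ` Pow (pverts G) =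
    (\<lambda>R. sat H (\<lambda>y. ys ! a y) ((\<lambda>Y. Ys ! b Y)(X := R)) p) ` Pow (pverts H)"
proof -
  have sat_eq: "sat G (\<lambda>y. xs ! a y) ((\<lambda>Y. Xs ! b Y)(X := S)) p \<longleftrightarrow>
      sat H (\<lambda>y. ys ! a y) ((\<lambda>Y. Ys ! b Y)(X := R)) p"
    if "ef_type q G xs (Xs @ [S]) = ef_type q H ys (Ys @ [R])" for S R
    using step[OF that] sat_append_set[of p X b Xs G _ S] sat_append_set[of p X b Ys H _ R] b len
    by simp
  show ?thesis
  proof (rule image_eqI_back_and_forth)
    show "\<exists>R\<in>Pow (pverts H). ef_type q G xs (Xs @ [S]) = ef_type q H ys (Ys @ [R])"
      if "S \<in> Pow (pverts G)" for S
      using ef_type_extend_set[OF fin eq, of S] that by auto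
    show "\<exists>S\<in>Pow (pverts G). ef_type q H ys (Ys @ [R]) = ef_type q G xs (Xs @ [S])"
      if "R \<in> Pow (pverts H)" for R
      using ef_type_extend_set[OF fin(2,1) eq[symmetric], of R] that by auto
  qed (rule sat_eq)
qed

lemma ball_bex_cong_image:
  assumes "P ` A = Q ` B"
  shows "(\<forall>x\<in>A. P x) \<longleftrightarrow> (\<forall>y\<in>B. Q y)" "(\<exists>x\<in>A. P x) \<longleftrightarrow> (\<exists>y\<in>B. Q y)"
proof -
  have "(\<forall>c\<in>P ` A. c) \<longleftrightarrow> (\<forall>c\<in>Q ` B. c)" "(\<exists>c\<in>P ` A. c) \<longleftrightarrow> (\<exists>c\<in>Q ` B. c)"
    by (simp_all only: assms)
  then show "(\<forall>x\<in>A. P x) \<longleftrightarrow> (\<forall>y\<in>B. Q y)" "(\<exists>x\<in>A. P x) \<longleftrightarrow> (\<exists>y\<in>B. Q y)"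
    by simp_all
qed

section \<open>Equal types agree on formulas of bounded depth\<close>

lemma pair_graph_finite_verts:
  assumes "pair_graph G"
  shows "finite (pverts G)"
proof -
  interpret pair_graph G by fact
  show ?thesis by (rule pair_finite_verts)
qed

text \<open>
  Extending by a set reduces the number of quantifiers; a vertex would not do, as there may be none.
\<close>

lemma ef_type_eq_atoms:
  fixes G H :: "'a pair_pre_digraph"
  assumes G: "pair_graph G" and H: "pair_graph H"
  shows "\<lbrakk>ef_type q G xs Xs = ef_type q H ys Ys; length xs = length ys; length Xs = length Ys;
      i < length xs\<rbrakk> \<Longrightarrow>
    (\<forall>j < length xs. ((xs ! i, xs ! j) \<in> parcs G \<longleftrightarrow> (ys ! i, ys ! j) \<in> parcs H) \<and>
      (xs ! i = xs ! j \<longleftrightarrow> ys ! i = ys ! j)) \<and>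
    (\<forall>n < length Xs. xs ! i \<in> Xs ! n \<longleftrightarrow> ys ! i \<in> Ys ! n)"
proof (induction q arbitrary: Xs Ys)
  case 0
  have "finite (diagram G xs Xs)" "finite (diagram H ys Ys)"
    by (simp_all add: diagram_def Let_def)
  then have "diagram G xs Xs = diagram H ys Ys"
    using 0(1) by (simp add: set_encode_eq)
  from diagram_cong[OF G H this 0(2-4)] show ?case
    by blast
next
  case (Suc q)
  obtain R where "ef_type q G xs (Xs @ [{}]) = ef_type q H ys (Ys @ [R])"
    using ef_type_extend_set[OF pair_graph_finite_verts[OF G] pair_graph_finite_verts[OF H]
      Suc.prems(1), of "{}"]
    by auto
  from Suc.IH[OF this] Suc.prems show ?case
    by (auto simp: nth_append less_Suc_eq)
qed

text \<open>
  The assignments \<open>a\<close> and \<open>b\<close> send variables to positions in the lists, so that a requantified variable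
  just moves to the newest position.
\<close>

lemma ef_type_eq_imp_sat_iff:
  fixes G H :: "'a pair_pre_digraph"
  assumes G: "pair_graph G" and H: "pair_graph H"
  shows "\<lbrakk>ef_type q G xs Xs = ef_type q H ys Ys; length xs = length ys; length Xs = length Ys;
      qdepth p \<le> q; \<And>x. x \<in> free1 p \<Longrightarrow> a x < length xs; \<And>X. X \<in> free2 p \<Longrightarrow> b X < length Xs\<rbrakk> \<Longrightarrow>
    sat G (\<lambda>x. xs ! a x) (\<lambda>X. Xs ! b X) p \<longleftrightarrow> sat H (\<lambda>x. ys ! a x) (\<lambda>X. Ys ! b X) p"
proof (induction p arbitrary: q xs Xs ys Ys a b)
  case (Adj x y)
  from ef_type_eq_atoms[OF G H Adj(1-3), of "a x"] Adj(5) show ?case by simp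
next
  case (Eq x y)
  from ef_type_eq_atoms[OF G H Eq(1-3), of "a x"] Eq(5) show ?case by simp
next
  case (Mem X x)
  from ef_type_eq_atoms[OF G H Mem(1-3), of "a x"] Mem(5,6) show ?case by simp
next
  case (Neg p)
  from Neg.IH[OF Neg.prems(1-3), of a b] Neg.prems show ?case by simp
next
  case (And p r)
  from And.IH(1)[OF And.prems(1-3), of a b] And.IH(2)[OF And.prems(1-3), of a b] And.prems
  show ?case by simp
next
  case (Or p r)
  from Or.IH(1)[OF Or.prems(1-3), of a b] Or.IH(2)[OF Or.prems(1-3), of a b] Or.prems
  show ?case by simp
next
  case (Imp p r)
  from Imp.IH(1)[OF Imp.prems(1-3), of a b] Imp.IH(2)[OF Imp.prems(1-3), of a b] Imp.prems
  show ?case by simp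
next
  case (Iff p r)
  from Iff.IH(1)[OF Iff.prems(1-3), of a b] Iff.IH(2)[OF Iff.prems(1-3), of a b] Iff.prems
  show ?case by simp
next
  case (All1 x p)
  then obtain q' where q: "q = Suc q'"
    by (cases q) auto
  have "sat G (\<lambda>y. (xs @ [v]) ! (a(x := length xs)) y) (\<lambda>Y. Xs ! b Y) p \<longleftrightarrow>
      sat H (\<lambda>y. (ys @ [w]) ! (a(x := length xs)) y) (\<lambda>Y. Ys ! b Y) p"
    if "ef_type q' G (xs @ [v]) Xs = ef_type q' H (ys @ [w]) Ys" for v w
    using All1.prems q by (intro All1.IH[OF that]) (auto simp: less_Suc_eq)
  from ball_bex_cong_image[OF ef_type_extend_vertex_sat[OF
    pair_graph_finite_verts[OF G] pair_graph_finite_verts[OF H] All1.prems(1)[unfolded q]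
    All1.prems(2,3) _ this]] All1.prems(5)
  show ?case by simp
next
  case (Ex1 x p)
  then obtain q' where q: "q = Suc q'"
    by (cases q) auto
  have "sat G (\<lambda>y. (xs @ [v]) ! (a(x := length xs)) y) (\<lambda>Y. Xs ! b Y) p \<longleftrightarrow>
      sat H (\<lambda>y. (ys @ [w]) ! (a(x := length xs)) y) (\<lambda>Y. Ys ! b Y) p"
    if "ef_type q' G (xs @ [v]) Xs = ef_type q' H (ys @ [w]) Ys" for v w
    using Ex1.prems q by (intro Ex1.IH[OF that]) (auto simp: less_Suc_eq)
  from ball_bex_cong_image[OF ef_type_extend_vertex_sat[OF
    pair_graph_finite_verts[OF G] pair_graph_finite_verts[OF H] Ex1.prems(1)[unfolded q]
    Ex1.prems(2,3) _ this]] Ex1.prems(5)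
  show ?case by simp
next
  case (All2 X p)
  then obtain q' where q: "q = Suc q'"
    by (cases q) auto
  have "sat G (\<lambda>y. xs ! a y) (\<lambda>Y. (Xs @ [S]) ! (b(X := length Xs)) Y) p \<longleftrightarrow>
      sat H (\<lambda>y. ys ! a y) (\<lambda>Y. (Ys @ [R]) ! (b(X := length Xs)) Y) p"
    if "ef_type q' G xs (Xs @ [S]) = ef_type q' H ys (Ys @ [R])" for S R
    using All2.prems q by (intro All2.IH[OF that]) (auto simp: less_Suc_eq)
  from ball_bex_cong_image[OF ef_type_extend_set_sat[OF
    pair_graph_finite_verts[OF G] pair_graph_finite_verts[OF H] All2.prems(1)[unfolded q]
    All2.prems(2,3) _ this]] All2.prems(6)
  show ?case by (simp add: Ball_def Bex_def)
next
  case (Ex2 X p)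
  then obtain q' where q: "q = Suc q'"
    by (cases q) auto
  have "sat G (\<lambda>y. xs ! a y) (\<lambda>Y. (Xs @ [S]) ! (b(X := length Xs)) Y) p \<longleftrightarrow>
      sat H (\<lambda>y. ys ! a y) (\<lambda>Y. (Ys @ [R]) ! (b(X := length Xs)) Y) p"
    if "ef_type q' G xs (Xs @ [S]) = ef_type q' H ys (Ys @ [R])" for S R
    using Ex2.prems q by (intro Ex2.IH[OF that]) (auto simp: less_Suc_eq)
  from ball_bex_cong_image[OF ef_type_extend_set_sat[OF
    pair_graph_finite_verts[OF G] pair_graph_finite_verts[OF H] Ex2.prems(1)[unfolded q]
    Ex2.prems(2,3) _ this]] Ex2.prems(6)
  show ?case by (simp add: Ball_def Bex_def)
qed

section \<open>Counting classes and tower estimates\<close>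

lemma card_quotient_le:
  fixes f :: "'a \<Rightarrow> nat"
  assumes R: "equiv A R" and f: "\<And>x. x \<in> A \<Longrightarrow> f x < N"
    and ker: "\<And>x y. \<lbrakk>x \<in> A; y \<in> A; f x = f y\<rbrakk> \<Longrightarrow> (x, y) \<in> R"
  shows "finite (A // R) \<and> card (A // R) \<le> N"
proof -
  \<comment> \<open>The class of \<open>x\<close> is recovered from \<open>f x\<close>: by
    \<open>ker\<close>, any element of \<open>A\<close> with this value is equivalent to
    \<open>x\<close>.\<close>
  define g where "g c = R `` {inv_into A f c}" for c
  have sub: "A // R \<subseteq> g ` {..<N}"
  proof
    fix C assume "C \<in> A // R"
    then obtain x where x: "x \<in> A" "C = R `` {x}"
      by (auto elim: quotientE)
    have "(inv_into A f (f x), x) \<in> R"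
      using x by (intro ker) (auto simp: inv_into_into f_inv_into_f)
    then have "g (f x) = C"
      unfolding g_def x(2) by (rule equiv_class_eq[OF R])
    then show "C \<in> g ` {..<N}"
      using f[OF x(1)] by blast
  qed
  have "card (A // R) \<le> card (g ` {..<N})"
    by (intro card_mono sub) simp
  also have "\<dots> \<le> N"
    using card_image_le[of "{..<N}" g] by simp
  finally show ?thesis
    using finite_subset[OF sub] by simp
qed

lemma square_le_two_power:
  "t \<ge> 1 \<Longrightarrow> t * (t - 1) + 2 \<le> 2 ^ (t::nat)"
proof (induction t rule: nat_induct_at_least)
  case (Suc t)
  \<comment> \<open>From \<open>t\<close> to \<open>t + 1\<close> the left-hand side grows by
    \<open>2 * t\<close> and the right-hand side by \<open>2 ^ t\<close>.\<close>
  have "2 * t \<le> 2 ^ t"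
    using Suc.hyps by (induction t rule: nat_induct_at_least) auto
  with Suc.IH Suc.hyps show ?case
    by (cases t) (auto simp: algebra_simps)
qed simp

lemma tower_log_star: "k \<le> tower (log_star k)"
proof -
  have "1 \<le> k + 1 \<and> k \<le> tower (k + 1)"
    using less_tower[of "k + 1"] by simp
  then show ?thesis
    unfolding log_star_def by (rule LeastI2) simp
qed

lemma type_bound_le_tower:
  assumes "k \<ge> 1"
  shows "2 * type_bound k q + 2 \<le> tower (q + 2 + log_star k)"
proof (induction q)
  case 0
  define t where "t = tower (log_star k)"
  have kt: "k \<le> t"
    by (simp add: t_def tower_log_star)
  have "2 * type_bound k 0 + 2 \<le> 2 ^ (k * (k - 1) + 2)"
    by simp
  also have "\<dots> \<le> 2 ^ (t * (t - 1) + 2)"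
    using kt by (intro power_increasing add_mono mult_le_mono) auto
  \<comment> \<open>Two exponentials above \<open>t = tower (log_star k)\<close>: this is the source
    of the summand 2 in the height of the tower.\<close>
  also have "\<dots> \<le> 2 ^ 2 ^ t"
    using kt assms by (intro power_increasing square_le_two_power) auto
  finally show ?case
    by (simp add: t_def)
next
  case (Suc q)
  \<comment> \<open>With \<open>x = 2 ^ (2 * type_bound k q) \<ge> 1\<close>, this is
    \<open>2 * x + 2 \<le> 4 * x\<close>.\<close>
  have "2 * type_bound k (Suc q) + 2 \<le> 2 ^ (2 * type_bound k q + 2)"
    by simp
  also have "\<dots> \<le> 2 ^ tower (q + 2 + log_star k)"
    using Suc by (intro power_increasing) auto
  finally show ?case
    by simp
qed

theorem theorem4:
  fixes k :: nat
  assumes "k \<ge> 1"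
  shows "finite ((finite_graphs :: 'a pair_pre_digraph set) // mso_equiv k) \<and>
         card ((finite_graphs :: 'a pair_pre_digraph set) // mso_equiv k)
           \<le> tower (k + 2 + log_star k)"
proof -
  have "finite ((finite_graphs :: 'a pair_pre_digraph set) // mso_equiv k) \<and>
        card ((finite_graphs :: 'a pair_pre_digraph set) // mso_equiv k) \<le> type_bound k k"
  proof (rule card_quotient_le[OF equiv_mso_equiv])
    fix G :: "'a pair_pre_digraph"
    show "ef_type k G [] [] < type_bound k k"
      by (rule ef_type_less_type_bound) simp
  next
    fix G H :: "'a pair_pre_digraph"
    assume GH: "G \<in> finite_graphs" "H \<in> finite_graphs"
      and eq: "ef_type k G [] [] = ef_type k H [] []"
    have "models G p \<longleftrightarrow> models H p" if p: "sentence p" "qdepth p \<le> k" for p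
    proof -
      \<comment> \<open>The entries of the empty lists are unspecified, but a sentence has no free
        variables, so the position bounds hold vacuously and the environments do not matter.\<close>
      have "sat G (\<lambda>x. [] ! id x) (\<lambda>X. [] ! id X) p \<longleftrightarrow> sat H (\<lambda>x. [] ! id x) (\<lambda>X. [] ! id X) p"
        using GH p by (intro ef_type_eq_imp_sat_iff[OF _ _ eq]) (auto simp: finite_graphs_def sentence_def)
      then show ?thesis
        using models_iff_sat[OF p(1)] by blast
    qed
    then show "(G, H) \<in> mso_equiv k"
      using GH by (simp add: mso_equiv_def)
  qed
  then show ?thesis
    using type_bound_le_tower[OF assms, of k] by auto
qed

end
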